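(* Let $G=(V,E)$ be a connected simple graph with at least two vertices. Then for every vertex $v_i\in V$, $$\mathcal{RE}_G(v_i)\leq 1,$$ and equality holds if $G$ is a star graph with $v_i$ being the center of the star.
   Context: All graphs are finite and simple. For a graph $G$ with vertices $v_1,\dots,v_n$, let $d_i$ be the degree of $v_i$. The Randić matrix $R(G)=(R_{ij})$ is the real symmetric $n\times n$ matrix with $R_{ij}=\frac{1}{\sqrt{d_id_j}}$ if $v_i$ and $v_j$ are adjacent and $R_{ij}=0$ otherwise. Put $|R(G)|=(R(G)R(G)^* )^{1/2}$ (positive semidefinite square root). The Randić energy of the vertex $v_i$ is $\mathcal{RE}_G(v_i)=|R(G)|_{ii}$, the $i$-th diagonal entry of $|R(G)|$. The star graph on $n\ge 2$ vertices is $S_n=K_{1,n-1}$; its center is the vertex adjacent to all others (for $n=2$, either vertex). *)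

theory Defs
  imports
    Complex_Main
    "Graph_Theory.Graph_Theory"
    "Jordan_Normal_Form.Schur_Decomposition"
begin

text \<open>
  A simple graph is a loop-free symmetric digraph without parallel arcs, i.e. an instance
  of the locale \<open>Digraph.graph\<close>: each edge is represented by a pair of opposite arcs, so
  adjacency is membership in \<open>arcs_ends\<close> and the degree of a vertex is its out-degree.

  A list \<open>vs\<close> enumerates the vertices \<open>v\<^sub>1, \<dots>, v\<^sub>n\<close>; list and matrix indices start at 0.
\<close>

definition vertex_enum :: "('a, 'b) pre_digraph \<Rightarrow> 'a list \<Rightarrow> bool" where
  "vertex_enum G vs \<longleftrightarrow> distinct vs \<and> set vs = verts G"

definition randic_mat :: "('a, 'b) pre_digraph \<Rightarrow> 'a list \<Rightarrow> real mat" where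
  "randic_mat G vs = mat (length vs) (length vs)
     (\<lambda>(i, j). if (vs ! i, vs ! j) \<in> arcs_ends G
               then 1 / sqrt (real (out_degree G (vs ! i)) * real (out_degree G (vs ! j)))
               else 0)"

definition psd_mat :: "real mat \<Rightarrow> bool" where
  "psd_mat A \<longleftrightarrow> square_mat A \<and> mat_adjoint A = A
     \<and> (\<forall>x \<in> carrier_vec (dim_row A). 0 \<le> x \<bullet> (A *\<^sub>v x))"

text \<open>
  A positive semidefinite matrix has exactly one positive semidefinite square root, so the
  description below is proper for such arguments (and unspecified for all others).
\<close>

definition psd_sqrt :: "real mat \<Rightarrow> real mat" where
  "psd_sqrt A = (THE B. B \<in> carrier_mat (dim_row A) (dim_row A) \<and> psd_mat B \<and> B * B = A)"

definition abs_mat :: "real mat \<Rightarrow> real mat" where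
  "abs_mat A = psd_sqrt (A * mat_adjoint A)"

definition randic_energy_vertex :: "('a, 'b) pre_digraph \<Rightarrow> 'a list \<Rightarrow> nat \<Rightarrow> real" where
  "randic_energy_vertex G vs i = abs_mat (randic_mat G vs) $$ (i, i)"

definition star_graph :: "('a, 'b) pre_digraph \<Rightarrow> bool" where
  "star_graph G \<longleftrightarrow>
     card (verts G) \<ge> 2 \<and> complete_bipartite_digraph 1 (card (verts G) - 1) G"

text \<open>In the star on two vertices, both vertices are centers.\<close>

definition star_center :: "('a, 'b) pre_digraph \<Rightarrow> 'a \<Rightarrow> bool" where
  "star_center G c \<longleftrightarrow> c \<in> verts G \<and> (\<forall>u \<in> verts G - {c}. (c, u) \<in> arcs_ends G)"

end

theory Submission
  imports Defs "Jordan_Normal_Form.Spectral_Radius"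
begin

text \<open>
  Write \<open>R\<close> for the Randic matrix and \<open>B = |R|\<close>, so that \<open>B\<close> is symmetric and
  \<open>B\<^sup>2 = R R\<^sup>T\<close>. Comparing diagonal entries, \<open>B\<^sub>i\<^sub>i\<^sup>2\<close> is one summand of
  \<open>(B\<^sup>2)\<^sub>i\<^sub>i = \<Sum>\<^sub>j R\<^sub>i\<^sub>j\<^sup>2\<close>, and the latter is the sum of \<open>1 / (d\<^sub>i d\<^sub>j)\<close> over the
  \<open>d\<^sub>i\<close> neighbors \<open>j\<close> of \<open>i\<close>. Each neighbor has degree at least 1, so this sum is at most 1.

  If \<open>i\<close> is the center of a star, then column \<open>i\<close> of \<open>R R\<^sup>T\<close> is the unit vector \<open>e\<^sub>i\<close>:
  its diagonal entry is 1 because every neighbor has degree exactly 1, and the other entries vanish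
  because two vertices with a common neighbor lie on the same side of the bipartition. So \<open>e\<^sub>i\<close>
  is an eigenvector of \<open>B\<^sup>2\<close> for the eigenvalue 1. A positive semidefinite matrix shares the
  eigenvectors of its square (\<open>psd_mat_eigenvector_of_square\<close>), hence \<open>B e\<^sub>i = e\<^sub>i\<close> and
  \<open>B\<^sub>i\<^sub>i = 1\<close>.

  Both arguments use only the characteristic properties of \<open>B\<close>. That \<open>B\<close> has them rests on the
  existence and uniqueness of positive semidefinite square roots (\<open>psd_sqrt_exists_unique\<close>), since
  the square root is given by a definite description. This follows from the spectral theorem for real
  symmetric matrices (\<open>symmetric_mat_orthogonal_diagonalization\<close>): the square roots of the
  eigenvalues give existence, and the eigenvector lemma fixes every square root on an orthonormal
  eigenbasis.
\<close>

section \<open>Real symmetric matrices\<close>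

lemma mat_adjoint_real: "mat_adjoint (A :: real mat) = transpose_mat A"
  by (rule eq_matI) (auto simp: mat_adjoint_def mat_of_rows_def)

lemma scalar_prod_self_nonneg: "0 \<le> (x :: real vec) \<bullet> x"
  by (auto simp: scalar_prod_def intro: sum_nonneg)

lemma scalar_prod_self_eq_0:
  assumes "(x :: real vec) \<in> carrier_vec n"
  shows "x \<bullet> x = 0 \<longleftrightarrow> x = 0\<^sub>v n"
proof
  assume "x \<bullet> x = 0"
  hence "\<forall>i \<in> {0..<n}. x $ i * x $ i = 0"
    using assms by (subst (asm) scalar_prod_def, subst (asm) sum_nonneg_eq_0_iff) auto
  thus "x = 0\<^sub>v n" using assms by (intro eq_vecI) auto
qed (auto simp: scalar_prod_def)

lemma symmetric_scalar_prod:
  assumes "A \<in> carrier_mat n n" "transpose_mat A = (A :: real mat)"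
    and "x \<in> carrier_vec n" "y \<in> carrier_vec n"
  shows "y \<bullet> (A *\<^sub>v x) = x \<bullet> (A *\<^sub>v y)"
  using transpose_vec_mult_scalar[OF assms(1,3,4)]
    comm_scalar_prod[OF assms(3) mult_mat_vec_carrier[OF assms(1,4)]] assms(2) by simp

text \<open>
  The complex spectrum is nonempty. If \<open>x + \<i> y\<close> is a complex eigenvector for \<open>a\<close>, symmetry of
  \<open>A\<close> applied to \<open>x\<close> and \<open>y\<close> yields \<open>Im a (x \<bullet> x + y \<bullet> y) = 0\<close>. So \<open>a\<close> is real, and one of
  the parts \<open>x\<close>, \<open>y\<close> is a nonzero real eigenvector, which can be normalized.
\<close>

lemma symmetric_mat_eigenvector:
  fixes A :: "real mat"
  assumes A: "A \<in> carrier_mat n n" and sym: "transpose_mat A = A" and n: "n > 0"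
  obtains v k where "v \<in> carrier_vec n" "v \<bullet> v = 1" "A *\<^sub>v v = k \<cdot>\<^sub>v v"
proof -
  let ?C = "map_mat complex_of_real A"
  have C: "?C \<in> carrier_mat n n" using A by auto
  obtain a where "eigenvalue ?C a"
    using spectrum_non_empty[OF C n] unfolding spectrum_def by auto
  then obtain z where z: "z \<in> carrier_vec n" "z \<noteq> 0\<^sub>v n" and ev: "?C *\<^sub>v z = a \<cdot>\<^sub>v z"
    unfolding eigenvalue_def eigenvector_def using A by auto
  define x where "x = map_vec Re z"
  define y where "y = map_vec Im z"
  have x: "x \<in> carrier_vec n" and y: "y \<in> carrier_vec n" using z by (auto simp: x_def y_def)
  have evi: "(\<Sum>j = 0..<n. complex_of_real (A $$ (i,j)) * z $ j) = a * z $ i" if "i < n" for i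
    using arg_cong[OF ev, of "\<lambda>v. v $ i"] that A z by (simp add: scalar_prod_def)
  \<comment> \<open>the real and imaginary parts of \<open>A z = a z\<close>, \<open>A\<close> being real\<close>
  have Ax: "A *\<^sub>v x = Re a \<cdot>\<^sub>v x - Im a \<cdot>\<^sub>v y"
    using A z arg_cong[OF evi, of _ Re]
    by (intro eq_vecI) (auto simp: scalar_prod_def x_def y_def)
  have Ay: "A *\<^sub>v y = Im a \<cdot>\<^sub>v x + Re a \<cdot>\<^sub>v y"
    using A z arg_cong[OF evi, of _ Im]
    by (intro eq_vecI) (auto simp: scalar_prod_def x_def y_def)
  have nz: "x \<noteq> 0\<^sub>v n \<or> y \<noteq> 0\<^sub>v n"
  proof (rule ccontr)
    assume "\<not> ?thesis"
    hence "\<forall>i<n. x $ i = 0 \<and> y $ i = 0" by auto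
    hence "z = 0\<^sub>v n" using z by (intro eq_vecI) (auto simp: x_def y_def complex_eq_iff)
    with z show False by simp
  qed
  have "y \<bullet> (A *\<^sub>v x) = x \<bullet> (A *\<^sub>v y)" by (rule symmetric_scalar_prod[OF A sym x y])
  hence "Im a * (x \<bullet> x + y \<bullet> y) = 0"
    unfolding Ax Ay using x y
    by (simp add: scalar_prod_add_distrib[of _ n] scalar_prod_minus_distrib[of _ n]
        comm_scalar_prod[OF y x] algebra_simps)
  moreover have "x \<bullet> x + y \<bullet> y \<noteq> 0"
    using nz scalar_prod_self_eq_0[OF x] scalar_prod_self_eq_0[OF y]
      scalar_prod_self_nonneg[of x] scalar_prod_self_nonneg[of y] by linarith
  ultimately have im: "Im a = 0" by simp
  have "A *\<^sub>v x = Re a \<cdot>\<^sub>v x" "A *\<^sub>v y = Re a \<cdot>\<^sub>v y"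
    using x y unfolding Ax Ay im by auto
  with nz x y obtain w where w: "w \<in> carrier_vec n" "w \<noteq> 0\<^sub>v n" "A *\<^sub>v w = Re a \<cdot>\<^sub>v w" by blast
  define c where "c = 1 / sqrt (w \<bullet> w)"
  have "w \<bullet> w > 0"
    using w scalar_prod_self_eq_0[OF w(1)] scalar_prod_self_nonneg[of w] by linarith
  hence "c * c * (w \<bullet> w) = 1" by (simp add: c_def)
  hence "(c \<cdot>\<^sub>v w) \<bullet> (c \<cdot>\<^sub>v w) = 1" using w by simp
  moreover have "A *\<^sub>v (c \<cdot>\<^sub>v w) = Re a \<cdot>\<^sub>v (c \<cdot>\<^sub>v w)"
    using mult_mat_vec[OF A w(1)] w by (simp add: smult_smult_assoc mult.commute)
  ultimately show ?thesis using that[of "c \<cdot>\<^sub>v w" "Re a"] w by auto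
qed

text \<open>
  This is the simplest way of completing a unit vector \<open>v\<close> to an orthonormal basis: the reflection
  that exchanges \<open>v\<close> and the first basis vector \<open>e\<close> is orthogonal and has \<open>v\<close> as its first column.
  Its mirror is orthogonal to \<open>w = v - e\<close>. For \<open>v = e\<close> the convention \<open>2 / 0 = 0\<close> turns the
  formula into the identity matrix, so most of the computation needs no case distinction.
\<close>

lemma householder_reflection:
  fixes v :: "real vec"
  assumes v: "v \<in> carrier_vec (Suc n)" and unit: "v \<bullet> v = 1"
  obtains H where "H \<in> carrier_mat (Suc n) (Suc n)" "transpose_mat H = H"
    "H * H = 1\<^sub>m (Suc n)" "H *\<^sub>v unit_vec (Suc n) 0 = v"
proof -
  let ?N = "Suc n"
  define w where "w = v - unit_vec ?N 0"
  define c where "c = 2 / (w \<bullet> w)"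
  define H where "H = mat ?N ?N (\<lambda>(i, j). of_bool (i = j) - c * w $ i * w $ j)"
  have w: "w \<in> carrier_vec ?N" using v by (simp add: w_def)
  have H: "H \<in> carrier_mat ?N ?N" by (simp add: H_def)
  have sym: "transpose_mat H = H" by (rule eq_matI) (auto simp: H_def)
  have ww: "(\<Sum>k = 0..<?N. w $ k * w $ k) = w \<bullet> w" using w by (simp add: scalar_prod_def)
  have cc: "c * c * (w \<bullet> w) = 2 * c" by (simp add: c_def)
  have w2: "w \<bullet> w = 2 - 2 * v $ 0"
    unfolding w_def using v unit
    by (simp add: minus_scalar_prod_distrib[of _ ?N] scalar_prod_minus_distrib[of _ ?N]
        scalar_prod_left_unit scalar_prod_right_unit)
  have HH: "(H * H) $$ (i, j) = of_bool (i = j)" if i: "i < ?N" and j: "j < ?N" for i j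
  proof -
    have "(H * H) $$ (i, j) = (\<Sum>k = 0..<?N.
        (of_bool (i = k) - c * w $ i * w $ k) * (of_bool (k = j) - c * w $ k * w $ j))"
      using i j H by (simp add: scalar_prod_def H_def del: sum.op_ivl_Suc)
    also have "\<dots> = (\<Sum>k = 0..<?N. (if k = i then of_bool (i = j) else 0)
        - (if k = j then c * w $ i * w $ j else 0) - (if k = i then c * w $ i * w $ j else 0)
        + c * c * w $ i * w $ j * (w $ k * w $ k))"
      by (intro sum.cong refl) (auto simp: algebra_simps)
    also have "\<dots> = of_bool (i = j) - 2 * c * w $ i * w $ j
        + w $ i * w $ j * (c * c * (w \<bullet> w))"
      unfolding sum.distrib sum_subtractf sum_distrib_left[symmetric] ww
      using i j by (simp add: algebra_simps del: sum.op_ivl_Suc)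
    finally show ?thesis unfolding cc by simp
  qed
  have "H * H = 1\<^sub>m ?N" using H HH by (intro eq_matI) auto
  moreover have "H *\<^sub>v unit_vec ?N 0 = v"
  proof (rule eq_vecI)
    fix i assume "i < dim_vec v"
    hence i: "i < ?N" using v by simp
    have "(H *\<^sub>v unit_vec ?N 0) $ i = of_bool (i = 0) - (c * w $ 0) * w $ i"
      using i H by (simp add: scalar_prod_right_unit H_def)
    also have "\<dots> = of_bool (i = 0) + w $ i"
    proof (cases "w \<bullet> w = 0")
      case True
      hence "w = 0\<^sub>v ?N" using scalar_prod_self_eq_0[OF w] by simp
      thus ?thesis using i by simp
    next
      case False
      moreover have "w $ 0 = - (w \<bullet> w) / 2" using w2 v by (simp add: w_def)
      ultimately have "c * w $ 0 = - 1" by (simp add: c_def)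
      thus ?thesis by simp
    qed
    also have "\<dots> = v $ i" using i v by (simp add: w_def)
    finally show "(H *\<^sub>v unit_vec ?N 0) $ i = v $ i" .
  qed (use H v in auto)
  ultimately show ?thesis using that H sym by blast
qed

text \<open>
  Induction on the dimension. Conjugating \<open>A\<close> by a reflection that moves the first basis vector to a
  unit eigenvector gives a symmetric matrix whose first column, hence also its first row, is
  zero off the diagonal. The induction hypothesis diagonalizes the remaining block.
\<close>

theorem symmetric_mat_orthogonal_diagonalization:
  fixes A :: "real mat"
  assumes "A \<in> carrier_mat n n" "transpose_mat A = A"
  shows "\<exists>U d. U \<in> carrier_mat n n \<and> transpose_mat U * U = 1\<^sub>m n \<and> A * U = U * mat_diag n d"
  using assms
proof (induction n arbitrary: A)
  case 0
  thus ?case by (intro exI[of _ "1\<^sub>m 0"] exI[of _ "\<lambda>_. 0"]) (auto simp: mat_diag_def intro!: eq_matI)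
next
  case (Suc n)
  let ?N = "Suc n"
  note A = Suc.prems(1) and sym = Suc.prems(2)
  obtain v k where v: "v \<in> carrier_vec ?N" "v \<bullet> v = 1" "A *\<^sub>v v = k \<cdot>\<^sub>v v"
    using symmetric_mat_eigenvector[OF A sym] by blast
  obtain H where H: "H \<in> carrier_mat ?N ?N" "transpose_mat H = H" "H * H = 1\<^sub>m ?N"
      "H *\<^sub>v unit_vec ?N 0 = v"
    using householder_reflection[OF v(1,2)] by blast
  define C where "C = H * (A * H)"
  have C: "C \<in> carrier_mat ?N ?N" using A H by (simp add: C_def)
  have symC: "transpose_mat C = C"
    using A H sym by (simp add: C_def transpose_mult[of _ ?N ?N _ ?N])
  have "(H * H) *\<^sub>v unit_vec ?N 0 = H *\<^sub>v v"
    unfolding H(4)[symmetric] by (rule assoc_mult_mat_vec[OF H(1,1)]) simp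
  hence Hv: "H *\<^sub>v v = unit_vec ?N 0" by (simp add: H(3))
  have "C *\<^sub>v unit_vec ?N 0 = H *\<^sub>v (k \<cdot>\<^sub>v v)"
    using A H v by (simp add: C_def assoc_mult_mat_vec[of _ ?N ?N _ ?N])
  hence Ce: "C *\<^sub>v unit_vec ?N 0 = k \<cdot>\<^sub>v unit_vec ?N 0"
    using mult_mat_vec[OF H(1) v(1)] Hv by simp
  have col0: "C $$ (i, 0) = (if i = 0 then k else 0)" if "i < ?N" for i
    using arg_cong[OF Ce, of "\<lambda>v. v $ i"] that C by (simp add: scalar_prod_right_unit)
  have row0: "C $$ (0, i) = (if i = 0 then k else 0)" if "i < ?N" for i
    using arg_cong[OF symC, of "\<lambda>M. M $$ (i, 0)"] col0[OF that] that C by simp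
  define A' where "A' = mat n n (\<lambda>(i, j). C $$ (Suc i, Suc j))"
  have A': "A' \<in> carrier_mat n n" by (simp add: A'_def)
  have "transpose_mat A' = A'"
  proof (rule eq_matI)
    fix i j assume "i < dim_row A'" "j < dim_col A'"
    thus "transpose_mat A' $$ (i, j) = A' $$ (i, j)"
      using arg_cong[OF symC, of "\<lambda>M. M $$ (Suc i, Suc j)"] C A' by (simp add: A'_def)
  qed (use A' in auto)
  from Suc.IH[OF A' this] obtain U' d where U': "U' \<in> carrier_mat n n"
      "transpose_mat U' * U' = 1\<^sub>m n" "A' * U' = U' * mat_diag n d" by blast
  let ?K = "mat 1 1 (\<lambda>_. k)"
  define W where "W = four_block_mat (1\<^sub>m 1) (0\<^sub>m 1 n) (0\<^sub>m n 1) U'"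
  define e where "e = (\<lambda>i. if i = 0 then k else d (i - 1))"
  have W: "W \<in> carrier_mat ?N ?N" using U' by (auto simp: W_def)
  have C_block: "C = four_block_mat ?K (0\<^sub>m 1 n) (0\<^sub>m n 1) A'"
    using C A' row0 col0 by (intro eq_matI) (auto simp: A'_def)
  have e_block: "mat_diag ?N e = four_block_mat ?K (0\<^sub>m 1 n) (0\<^sub>m n 1) (mat_diag n d)"
    by (intro eq_matI) (auto simp: mat_diag_def e_def)
  have CW: "C * W = W * mat_diag ?N e"
    unfolding C_block W_def e_block using A' U'
    by (simp add: mult_four_block_mat[of _ 1 1 _ n _ n _ _ 1 _ n]
        left_mult_zero_mat[of "mat_diag n d" n n])
  have WW: "transpose_mat W * W = 1\<^sub>m ?N"
  proof -
    have "transpose_mat W * W = four_block_mat (1\<^sub>m 1) (0\<^sub>m 1 n) (0\<^sub>m n 1) (1\<^sub>m n)"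
      unfolding W_def using U'
      by (simp add: transpose_four_block_mat[of _ 1 1 _ n _ n]
          mult_four_block_mat[of _ 1 1 _ n _ n _ _ 1 _ n])
    also have "\<dots> = 1\<^sub>m ?N" by (intro eq_matI) auto
    finally show ?thesis .
  qed
  define U where "U = H * W"
  have U: "U \<in> carrier_mat ?N ?N" using H W by (simp add: U_def)
  have "transpose_mat U * U = transpose_mat W * ((H * H) * W)"
    using H(1,2) W
    by (simp add: U_def transpose_mult[of _ ?N ?N _ ?N] assoc_mult_mat[of _ ?N ?N _ ?N _ ?N])
  hence UU: "transpose_mat U * U = 1\<^sub>m ?N"
    unfolding H(3) using W WW by simp
  have "A * U = (H * H) * (A * (H * W))" using A H W by (simp add: U_def)
  also have "\<dots> = H * (C * W)"
    using A H(1) W by (simp add: C_def assoc_mult_mat[of _ ?N ?N _ ?N _ ?N])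
  also have "\<dots> = U * mat_diag ?N e"
    unfolding CW U_def using H(1) W by (simp add: assoc_mult_mat[of _ ?N ?N _ ?N _ ?N])
  finally show ?case using U UU by blast
qed

section \<open>Positive semidefinite square roots\<close>

lemma psd_matI:
  assumes "A \<in> carrier_mat n n" "transpose_mat A = A"
    and "\<And>x. x \<in> carrier_vec n \<Longrightarrow> 0 \<le> x \<bullet> (A *\<^sub>v x)"
  shows "psd_mat A"
  using assms by (auto simp: psd_mat_def mat_adjoint_real)

lemma psd_matD:
  assumes "psd_mat A" "A \<in> carrier_mat n n"
  shows "transpose_mat A = A" "\<And>x. x \<in> carrier_vec n \<Longrightarrow> 0 \<le> x \<bullet> (A *\<^sub>v x)"
  using assms by (auto simp: psd_mat_def mat_adjoint_real)

lemma psd_mat_transpose_congruence: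
  assumes Q: "Q \<in> carrier_mat n m" and B: "B \<in> carrier_mat m m" "psd_mat B"
  shows "psd_mat (Q * B * transpose_mat Q)"
proof (rule psd_matI)
  show "Q * B * transpose_mat Q \<in> carrier_mat n n" using Q B by simp
  show "transpose_mat (Q * B * transpose_mat Q) = Q * B * transpose_mat Q"
    using Q B psd_matD(1)[OF B(2,1)]
    by (simp add: transpose_mult[of _ n m _ n] transpose_mult[of _ m m _ n])
  fix x :: "real vec" assume x: "x \<in> carrier_vec n"
  let ?y = "transpose_mat Q *\<^sub>v x"
  have y: "?y \<in> carrier_vec m" using Q x by simp
  have "x \<bullet> ((Q * B * transpose_mat Q) *\<^sub>v x) = x \<bullet> (Q *\<^sub>v (B *\<^sub>v ?y))"
    using Q B x by (simp add: assoc_mult_mat_vec[of _ n m _ n] assoc_mult_mat_vec[of _ n m _ m])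
  also have "\<dots> = ?y \<bullet> (B *\<^sub>v ?y)"
    using Q B x y by (simp add: transpose_vec_mult_scalar[of _ n m])
  finally show "0 \<le> x \<bullet> ((Q * B * transpose_mat Q) *\<^sub>v x)"
    using psd_matD(2)[OF B(2,1) y] by simp
qed

lemma psd_mat_diag:
  assumes "\<And>i. i < n \<Longrightarrow> 0 \<le> d i"
  shows "psd_mat (mat_diag n d)"
proof (rule psd_matI)
  show "transpose_mat (mat_diag n d) = mat_diag n d" by (rule eq_matI) (auto simp: mat_diag_def)
  fix x :: "real vec" assume x: "x \<in> carrier_vec n"
  have "(mat_diag n d *\<^sub>v x) $ i = d i * x $ i" if "i < n" for i
    using that x by (simp add: mat_diag_def scalar_prod_def if_distrib[of "\<lambda>t. t * _"] cong: if_cong)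
  hence "x \<bullet> (mat_diag n d *\<^sub>v x) = (\<Sum>i = 0..<n. d i * (x $ i * x $ i))"
    using x by (simp add: scalar_prod_def mat_diag_def algebra_simps)
  thus "0 \<le> x \<bullet> (mat_diag n d *\<^sub>v x)" using assms by (auto intro!: sum_nonneg mult_nonneg_nonneg[OF _ zero_le_square])
qed auto

text \<open>
  The vector \<open>y = B v - s v\<close> satisfies \<open>(B + s) y = 0\<close>, because \<open>(B + s) (B - s) = B\<^sup>2 - s\<^sup>2\<close>.
  For \<open>s > 0\<close>, positivity of \<open>B\<close> rules out the eigenvalue \<open>- s\<close>, so \<open>y = 0\<close>. For \<open>s = 0\<close>,
  symmetry gives \<open>(B v) \<bullet> (B v) = v \<bullet> (B\<^sup>2 v) = 0\<close>.
\<close>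

lemma psd_mat_eigenvector_of_square:
  assumes B: "B \<in> carrier_mat n n" "psd_mat B" and v: "v \<in> carrier_vec n"
    and s: "0 \<le> s" and ev: "(B * B) *\<^sub>v v = (s * s) \<cdot>\<^sub>v v"
  shows "B *\<^sub>v v = s \<cdot>\<^sub>v v"
proof -
  define y where "y = B *\<^sub>v v - s \<cdot>\<^sub>v v"
  have y: "y \<in> carrier_vec n" using B v by (simp add: y_def)
  have Bv: "B *\<^sub>v v \<in> carrier_vec n" using B v by simp
  have "B *\<^sub>v y = (s * s) \<cdot>\<^sub>v v - s \<cdot>\<^sub>v (B *\<^sub>v v)"
    using B v Bv ev
    by (simp add: y_def mult_minus_distrib_mat_vec[of _ n n] mult_mat_vec[of _ n n])
  also have "\<dots> = - s \<cdot>\<^sub>v y"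
    using B v by (intro eq_vecI) (auto simp: y_def algebra_simps)
  finally have By: "B *\<^sub>v y = - s \<cdot>\<^sub>v y" .
  have "y = 0\<^sub>v n"
  proof (cases "s = 0")
    case True
    hence "v \<bullet> (B *\<^sub>v (B *\<^sub>v v)) = 0" using B v ev by (simp add: scalar_prod_def)
    moreover have "v \<bullet> (B *\<^sub>v (B *\<^sub>v v)) = (B *\<^sub>v v) \<bullet> (B *\<^sub>v v)"
      by (rule symmetric_scalar_prod[OF B(1) psd_matD(1)[OF B(2,1)] Bv v])
    ultimately have "B *\<^sub>v v = 0\<^sub>v n" using scalar_prod_self_eq_0[OF Bv] by simp
    thus ?thesis using v True by (auto simp: y_def)
  next
    case False
    have "0 \<le> y \<bullet> (B *\<^sub>v y)" by (rule psd_matD(2)[OF B(2,1) y])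
    hence "s * (y \<bullet> y) \<le> 0" using By y by simp
    with False s have "y \<bullet> y \<le> 0" by (simp add: mult_le_0_iff)
    thus ?thesis using scalar_prod_self_nonneg[of y] scalar_prod_self_eq_0[OF y] by simp
  qed
  show ?thesis
  proof (rule eq_vecI)
    fix i assume "i < dim_vec (s \<cdot>\<^sub>v v)"
    thus "(B *\<^sub>v v) $ i = (s \<cdot>\<^sub>v v) $ i"
      using arg_cong[OF \<open>y = 0\<^sub>v n\<close>, of "\<lambda>u. u $ i"] v B by (simp add: y_def)
  qed (use B v in auto)
qed

text \<open>
  Let the columns of \<open>U\<close> be an orthonormal eigenbasis of \<open>A\<close>. Conjugating the diagonal matrix of
  the \<open>sqrt (d i)\<close> by \<open>U\<close> gives a square root. Conversely, any square root \<open>B\<close> maps each column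
  of \<open>U\<close> to its \<open>sqrt (d i)\<close>-fold by the eigenvector lemma, which determines \<open>B\<close>.
\<close>

theorem psd_sqrt_exists_unique:
  assumes A: "A \<in> carrier_mat n n" "psd_mat A"
  shows "\<exists>!B. B \<in> carrier_mat n n \<and> psd_mat B \<and> B * B = A"
proof -
  obtain U d where U: "U \<in> carrier_mat n n" "transpose_mat U * U = 1\<^sub>m n"
      and AU: "A * U = U * mat_diag n d"
    using symmetric_mat_orthogonal_diagonalization[OF A(1) psd_matD(1)[OF A(2,1)]] by blast
  have Ut: "transpose_mat U \<in> carrier_mat n n" using U by simp
  have UU: "U * transpose_mat U = 1\<^sub>m n"
    by (rule mat_mult_left_right_inverse[OF Ut U])
  have D: "mat_diag n f \<in> carrier_mat n n" for f :: "nat \<Rightarrow> real" by simp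
  note assoc = assoc_mult_mat[of _ n n _ n _ n] mult_carrier_mat[of _ n n _ n]
  have col_AU: "A *\<^sub>v col U i = d i \<cdot>\<^sub>v col U i" if i: "i < n" for i
  proof -
    have "A *\<^sub>v col U i = col (A * U) i" by (rule col_mult2[OF A(1) U(1) i, symmetric])
    also have "\<dots> = d i \<cdot>\<^sub>v col U i"
      unfolding AU mat_diag_mult_right[OF U(1)] using U i by (intro eq_vecI) auto
    finally show ?thesis .
  qed
  have unit: "col U i \<bullet> col U i = 1" if i: "i < n" for i
    using arg_cong[OF U(2), of "\<lambda>M. M $$ (i, i)"] U(1) i by simp
  have d: "0 \<le> d i" if i: "i < n" for i
    using psd_matD(2)[OF A(2,1), of "col U i"] col_AU[OF i] unit[OF i] U(1) i by simp
  let ?S = "mat_diag n (\<lambda>i. sqrt (d i))"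
  let ?R = "U * ?S * transpose_mat U"
  have SS: "?S * ?S = mat_diag n d"
    unfolding mat_diag_diag using d by (intro eq_matI) (auto simp: mat_diag_def)
  have "?R * ?R = U * (?S * ((transpose_mat U * U) * (?S * transpose_mat U)))"
    using U(1) Ut D by (simp add: assoc)
  also have "\<dots> = U * (?S * ?S) * transpose_mat U"
    unfolding U(2) using U(1) Ut D by (simp add: assoc left_mult_one_mat[of _ n n] del: mat_diag_diag)
  also have "\<dots> = A * (U * transpose_mat U)"
    unfolding SS AU[symmetric] using A(1) U(1) Ut by (simp add: assoc)
  finally have RR: "?R * ?R = A" unfolding UU using A by simp
  show ?thesis
  proof (rule ex1I[of _ ?R])
    show "?R \<in> carrier_mat n n \<and> psd_mat ?R \<and> ?R * ?R = A"
      using U(1) RR psd_mat_transpose_congruence[OF U(1) D psd_mat_diag] d by auto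
    fix B assume B: "B \<in> carrier_mat n n \<and> psd_mat B \<and> B * B = A"
    have "B *\<^sub>v col U i = sqrt (d i) \<cdot>\<^sub>v col U i" if i: "i < n" for i
      by (rule psd_mat_eigenvector_of_square[of _ n]) (use B U(1) i d[OF i] col_AU[OF i] in auto)
    hence "B * U = U * ?S"
      unfolding mat_diag_mult_right[OF U(1)]
      using B U(1) by (intro mat_col_eqI) (auto simp: col_mult2[of _ n n _ n] intro!: eq_vecI)
    hence "?R = B * (U * transpose_mat U)" using B U(1) Ut by (simp add: assoc(1)[symmetric] assoc(2))
    thus "B = ?R" unfolding UU using B right_mult_one_mat[of B n n] by simp
  qed
qed

lemma abs_mat_properties:
  assumes M: "M \<in> carrier_mat n n"
  shows "abs_mat M \<in> carrier_mat n n" "psd_mat (abs_mat M)"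
    "abs_mat M * abs_mat M = M * transpose_mat M"
proof -
  let ?A = "M * transpose_mat M"
  have A: "?A \<in> carrier_mat n n" using M by simp
  have "psd_mat (M * 1\<^sub>m n * transpose_mat M)"
    using psd_mat_transpose_congruence[OF M, of "1\<^sub>m n"] psd_mat_diag[of n "\<lambda>_. 1"] by simp
  hence "psd_mat ?A" using M by simp
  from theI'[OF psd_sqrt_exists_unique[OF A this]]
  show "abs_mat M \<in> carrier_mat n n" "psd_mat (abs_mat M)"
    "abs_mat M * abs_mat M = M * transpose_mat M"
    using M by (simp_all add: abs_mat_def psd_sqrt_def mat_adjoint_real)
qed

text \<open>
  The square of a diagonal entry of \<open>|M|\<close> is one summand in the squared norm of its row, and
  \<open>|M|\<close> and \<open>M\<close> have rows of equal norm since \<open>|M|\<^sup>2 = M M\<^sup>T\<close>.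
\<close>

lemma abs_mat_diag_square_le:
  assumes M: "M \<in> carrier_mat n n" and i: "i < n"
  shows "(abs_mat M $$ (i, i))\<^sup>2 \<le> (\<Sum>j = 0..<n. (M $$ (i, j))\<^sup>2)"
proof -
  let ?B = "abs_mat M"
  note B = abs_mat_properties[OF M]
  have sq: "(X * transpose_mat X) $$ (i, i) = (\<Sum>j = 0..<n. (X $$ (i, j))\<^sup>2)"
    if "X \<in> carrier_mat n n" for X :: "real mat"
    using that i by (simp add: scalar_prod_def power2_eq_square)
  have "(?B $$ (i, i))\<^sup>2 \<le> (\<Sum>j = 0..<n. (?B $$ (i, j))\<^sup>2)"
    using i by (intro member_le_sum) auto
  also have "\<dots> = (\<Sum>j = 0..<n. (M $$ (i, j))\<^sup>2)"
    using sq[OF B(1)] sq[OF M] B(3) psd_matD(1)[OF B(2,1)] by simp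
  finally show ?thesis .
qed

text \<open>
  A vector fixed by \<open>|M|\<^sup>2 = M M\<^sup>T\<close>, here the \<open>i\<close>-th unit vector, is fixed by \<open>|M|\<close> itself:
  this is the eigenvector lemma for the eigenvalue 1.
\<close>

lemma abs_mat_diag_eq_1:
  assumes M: "M \<in> carrier_mat n n" and i: "i < n"
    and col: "\<And>j. j < n \<Longrightarrow> (M * transpose_mat M) $$ (j, i) = of_bool (j = i)"
  shows "abs_mat M $$ (i, i) = 1"
proof -
  note B = abs_mat_properties[OF M]
  let ?e = "unit_vec n i :: real vec"
  have "(M * transpose_mat M) *\<^sub>v ?e = ?e"
  proof (rule eq_vecI)
    fix j assume "j < dim_vec ?e"
    thus "((M * transpose_mat M) *\<^sub>v ?e) $ j = ?e $ j"
      using M i col[of j]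
      by (simp add: scalar_prod_right_unit del: assoc_mult_mat_vec)
  qed (use M in auto)
  hence "abs_mat M *\<^sub>v ?e = 1 \<cdot>\<^sub>v ?e"
    by (intro psd_mat_eigenvector_of_square[OF B(1,2)]) (auto simp: B(3))
  from arg_cong[OF this, of "\<lambda>v. v $ i"] show ?thesis
    using B(1) i by (simp add: scalar_prod_right_unit)
qed


section \<open>The Randic matrix\<close>

lemma (in nomulti_digraph) out_degree_eq_card_neighbors:
  "out_degree G v = card {u. (v, u) \<in> arcs_ends G}"
proof -
  have "inj_on (head G) (out_arcs G v)"
    using no_multi_arcs by (auto simp: inj_on_def out_arcs_def arc_to_ends_def)
  moreover have "head G ` out_arcs G v = {u. (v, u) \<in> arcs_ends G}"
    by (auto simp: out_arcs_def arcs_ends_conv)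
  ultimately show ?thesis using card_image unfolding out_degree_def by fastforce
qed

lemma card_neighbor_indices:
  assumes "Digraph.graph G" "vertex_enum G vs"
  shows "card {j \<in> {0..<length vs}. (v, vs ! j) \<in> arcs_ends G} = out_degree G v"
proof -
  interpret graph G by fact
  let ?N = "{j \<in> {0..<length vs}. (v, vs ! j) \<in> arcs_ends G}"
  have dist: "distinct vs" and set: "set vs = verts G"
    using assms(2) by (auto simp: vertex_enum_def)
  have "(!) vs ` ?N = {u. (v, u) \<in> arcs_ends G}"
  proof (intro equalityI subsetI)
    fix u assume u: "u \<in> {u. (v, u) \<in> arcs_ends G}"
    hence "u \<in> set vs" using adj_in_verts(2)[of v u] set by simp
    then obtain j where "j < length vs" "vs ! j = u" by (auto simp: in_set_conv_nth)
    thus "u \<in> (!) vs ` ?N" using u by auto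
  qed auto
  moreover have "inj_on ((!) vs) ?N" using dist by (auto simp: inj_on_def nth_eq_iff_index_eq)
  ultimately show ?thesis using card_image[of "(!) vs" ?N] out_degree_eq_card_neighbors[of v] by argo
qed

lemma randic_mat_carrier: "randic_mat G vs \<in> carrier_mat (length vs) (length vs)"
  by (simp add: randic_mat_def)

text \<open>
  Adjacency is symmetric, so a neighbor \<open>j\<close> of \<open>i\<close> has \<open>d\<^sub>j \<ge> 1\<close> and contributes at most
  \<open>1 / d\<^sub>i\<close>; there are \<open>d\<^sub>i\<close> such contributions. For an isolated vertex the sum is empty.
\<close>

lemma randic_mat_row_square_sum_le_1:
  assumes G: "Digraph.graph G" and vs: "vertex_enum G vs" and i: "i < length vs"
  shows "(\<Sum>j = 0..<length vs. (randic_mat G vs $$ (i, j))\<^sup>2) \<le> 1"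
proof -
  interpret graph G by fact
  let ?adj = "\<lambda>j. (vs ! i, vs ! j) \<in> arcs_ends G"
  let ?d = "\<lambda>j. real (out_degree G (vs ! j))"
  have "(randic_mat G vs $$ (i, j))\<^sup>2 \<le> (if ?adj j then 1 / ?d i else 0)"
    if j: "j < length vs" for j
  proof (cases "?adj j")
    case True
    hence "(vs ! j, vs ! i) \<in> arcs_ends G" by (rule graph_symmetric)
    hence "i \<in> {k \<in> {0..<length vs}. (vs ! j, vs ! k) \<in> arcs_ends G}" using i by simp
    hence "out_degree G (vs ! j) \<noteq> 0"
      unfolding card_neighbor_indices[OF G vs, symmetric] by (auto simp: card_eq_0_iff)
    hence "1 \<le> ?d j" by simp
    hence "?d i * 1 \<le> ?d i * ?d j" by (intro mult_left_mono) auto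
    hence "1 / (?d i * ?d j) \<le> 1 / ?d i"
      by (cases "out_degree G (vs ! i) = 0") (auto intro!: divide_left_mono)
    thus ?thesis using True i j by (simp add: randic_mat_def power_divide)
  qed (use i j in \<open>simp add: randic_mat_def\<close>)
  hence "(\<Sum>j = 0..<length vs. (randic_mat G vs $$ (i, j))\<^sup>2)
      \<le> (\<Sum>j = 0..<length vs. if ?adj j then 1 / ?d i else 0)"
    by (intro sum_mono) auto
  also have "\<dots> = real (card {j \<in> {0..<length vs}. ?adj j}) * (1 / ?d i)"
    by (subst sum.inter_filter[symmetric]) auto
  also have "\<dots> \<le> 1" unfolding card_neighbor_indices[OF G vs] by simp
  finally show ?thesis .
qed

text \<open>
  The center in the sense of \<open>star_center\<close> need not be the vertex \<open>u\<close> forming the singleton side of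
  the bipartition. If it lies on the other side, it is adjacent to no vertex of that side, so that side
  is \<open>{c}\<close> and the star is a single edge, which is symmetric in its two ends.
\<close>

lemma star_arcs_ends:
  assumes "star_graph G" "star_center G c"
  shows "arcs_ends G = {c} \<times> (verts G - {c}) \<union> (verts G - {c}) \<times> {c}"
proof -
  obtain U V where UV: "verts G = U \<union> V" "U \<inter> V = {}" "card U = 1"
      "arcs_ends G = U \<times> V \<union> V \<times> U"
    using assms(1) unfolding star_graph_def complete_bipartite_digraph_def by blast
  then obtain u where U: "U = {u}" by (auto simp: card_1_singleton_iff)
  have c: "c \<in> U \<union> V" "\<And>w. w \<in> verts G - {c} \<Longrightarrow> (c, w) \<in> arcs_ends G"
    using assms(2) UV(1) by (auto simp: star_center_def)
  show ?thesis
  proof (cases "c = u")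
    case True
    hence "verts G - {c} = V" using UV U by auto
    thus ?thesis using UV U True by simp
  next
    case False
    have "V = {c}"
    proof (intro equalityI subsetI)
      fix w assume w: "w \<in> V"
      show "w \<in> {c}"
      proof (rule ccontr)
        assume "w \<notin> {c}"
        hence "(c, w) \<in> U \<times> V \<union> V \<times> U" using c(2)[of w] w UV by auto
        thus False using False U UV(2) w by auto
      qed
    qed (use c U False in auto)
    moreover from this have "verts G - {c} = {u}" using UV U False by auto
    ultimately show ?thesis using UV U by auto
  qed
qed

text \<open>
  With \<open>n\<close> vertices, all nonzero entries of \<open>R\<close> equal \<open>1 / sqrt (n - 1)\<close> and join the center to a
  leaf. The diagonal entry sums \<open>n - 1\<close> of their squares. For a leaf \<open>j\<close> the rows of \<open>j\<close> and of
  the center have disjoint supports.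
\<close>

lemma star_randic_square_center_column:
  assumes G: "Digraph.graph G" and vs: "vertex_enum G vs" and i: "i < length vs"
    and two: "card (verts G) \<ge> 2"
    and star: "star_graph G" "star_center G (vs ! i)" and j: "j < length vs"
  shows "(randic_mat G vs * transpose_mat (randic_mat G vs)) $$ (j, i) = of_bool (j = i)"
proof -
  interpret graph G by fact
  let ?R = "randic_mat G vs" and ?n = "length vs"
  let ?d = "\<lambda>j. out_degree G (vs ! j)"
  have dist: "distinct vs" and set: "set vs = verts G"
    using vs by (auto simp: vertex_enum_def)
  have adj: "(vs ! k, vs ! l) \<in> arcs_ends G \<longleftrightarrow> (k = i) \<noteq> (l = i)" if "k < ?n" "l < ?n" for k l
    unfolding star_arcs_ends[OF star] set[symmetric]
    using that i dist by (auto simp: nth_eq_iff_index_eq)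
  have n: "?n \<ge> 2" using two dist set by (metis distinct_card)
  have "{l \<in> {0..<?n}. (vs ! i, vs ! l) \<in> arcs_ends G} = {0..<?n} - {i}"
    using adj i by auto
  hence d_center: "?d i = ?n - 1"
    using card_neighbor_indices[OF G vs, of "vs ! i"] i by simp
  have d_leaf: "?d k = 1" if k: "k < ?n" "k \<noteq> i" for k
  proof -
    have "{l \<in> {0..<?n}. (vs ! k, vs ! l) \<in> arcs_ends G} = {i}" using adj k i by auto
    thus ?thesis using card_neighbor_indices[OF G vs, of "vs ! k"] by simp
  qed
  have R: "?R $$ (k, l) = (if (k = i) \<noteq> (l = i) then 1 / sqrt (real (?n - 1)) else 0)"
    if "k < ?n" "l < ?n" for k l
    using that adj[OF that] d_center d_leaf by (auto simp: randic_mat_def)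
  have "(?R * transpose_mat ?R) $$ (j, i) = (\<Sum>k = 0..<?n. ?R $$ (j, k) * ?R $$ (i, k))"
    using i j randic_mat_carrier[of G vs] by (simp add: scalar_prod_def)
  also have "\<dots> = (\<Sum>k = 0..<?n. if j = i \<and> k \<noteq> i then 1 / real (?n - 1) else 0)"
    using i j by (intro sum.cong) (auto simp: R)
  also have "\<dots> = (\<Sum>k \<in> {0..<?n} - {i}. of_bool (j = i) / real (?n - 1))"
    by (rule sum.mono_neutral_cong_right) auto
  also have "\<dots> = of_bool (j = i)" using i n by simp
  finally show ?thesis .
qed

theorem theorem3p4:
  fixes G :: "('a, 'b) pre_digraph" and vs :: "'a list" and i :: nat
  assumes "Digraph.graph G"
    and "Digraph_Component.connected G"
    and "card (verts G) \<ge> 2"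
    and "vertex_enum G vs"
    and "i < length vs"
  shows "randic_energy_vertex G vs i \<le> 1
    \<and> (star_graph G \<and> star_center G (vs ! i) \<longrightarrow> randic_energy_vertex G vs i = 1)"
proof (intro conjI impI)
  have "(randic_energy_vertex G vs i)\<^sup>2 \<le> (\<Sum>j = 0..<length vs. (randic_mat G vs $$ (i, j))\<^sup>2)"
    unfolding randic_energy_vertex_def
    by (rule abs_mat_diag_square_le[OF randic_mat_carrier assms(5)])
  also have "\<dots> \<le> 1\<^sup>2" using randic_mat_row_square_sum_le_1[OF assms(1,4,5)] by simp
  finally show "randic_energy_vertex G vs i \<le> 1" by (rule power2_le_imp_le) simp
next
  assume star: "star_graph G \<and> star_center G (vs ! i)"
  show "randic_energy_vertex G vs i = 1"
    unfolding randic_energy_vertex_def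
    by (rule abs_mat_diag_eq_1[OF randic_mat_carrier assms(5)],
        rule star_randic_square_center_column[OF assms(1,4,5,3)]) (use star in auto)
qed

end
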